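(* Let $(\alpha,\beta)$ be a random vector in $\mathbb{R}^2$ such that (i) $\mathbb{P}(\alpha\neq 0)=1$; (ii) $\mathbb{P}(|\alpha|\neq 1)>0$; (iii) for every $c\in\mathbb{R}$, $\mathbb{P}(\alpha(c-\beta)=c)<1$. Assume that $$0<\mathbb{E}\{\ln|\alpha|\}<\infty,\qquad \mathbb{E}\{\ln\max(|\beta|,1)\}<\infty .$$ Let $y:\mathbb{R}\to\mathbb{R}$ be a bounded (not necessarily continuous) solution of $$y(x)=\mathbb{E}\{y(\alpha(x-\beta))\},\qquad x\in\mathbb{R},$$ and denote $$m^{\pm}:=\liminf_{x\to\pm\infty}y(x),\qquad M^{\pm}:=\limsup_{x\to\pm\infty}y(x).$$ Then $$m\le y(x)\le M,\qquad x\in\mathbb{R},$$ where $m:=\min\{m^{+},m^{-}\}$ and $M:=\max\{M^{+},M^{-}\}$.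
   Context: A bounded solution means a bounded Borel measurable function $y:\mathbb{R}\to\mathbb{R}$ satisfying the equation for every $x\in\mathbb{R}$. Expectations $\mathbb{E}$ are taken with respect to the joint distribution of $(\alpha,\beta)$; $\alpha$ and $\beta$ need not be independent of each other. *)

theory Defs
  imports "HOL-Probability.Probability"
begin

text \<open>The integrand in the equation is bounded and measurable as soon as \<open>y\<close> is bounded and
  Borel and \<open>\<alpha>\<close>, \<open>\<beta>\<close> are random variables, so the Bochner integral is the genuine expectation.\<close>

definition bounded_solution ::
  "'a measure \<Rightarrow> ('a \<Rightarrow> real) \<Rightarrow> ('a \<Rightarrow> real) \<Rightarrow> (real \<Rightarrow> real) \<Rightarrow> bool" where
  "bounded_solution P \<alpha> \<beta> y \<longleftrightarrow>
     y \<in> borel_measurable borel \<and> bounded (range y) \<and>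
     (\<forall>x. y x = (\<integral>\<omega>. y (\<alpha> \<omega> * (x - \<beta> \<omega>)) \<partial>P))"

end

theory Submission
  imports Defs
begin

text \<open>Iterating \<open>x \<mapsto> \<alpha> * (x - \<beta>)\<close> with i.i.d. copies \<open>(a\<^sub>k, b\<^sub>k)\<close> of the coefficients gives
  \<open>X\<^sub>n = A\<^sub>n * (x - (\<Sum>k<n. b\<^sub>k / A\<^sub>k))\<close> with \<open>A\<^sub>n = a\<^sub>0 * \<dots> * a\<^sub>n\<^sub>-\<^sub>1\<close>, and \<open>y x = \<E> (y X\<^sub>n)\<close> for all \<open>n\<close>. Since
  \<open>\<E> (ln \<bar>\<alpha>\<bar>) > 0\<close>, almost surely \<open>\<bar>A\<^sub>n\<bar>\<close> grows exponentially while \<open>b\<^sub>n\<close> grows subexponentially, so the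
  series converges to a random variable \<open>Z\<close>. Its law has no atoms, so \<open>x \<noteq> Z\<close> and \<open>\<bar>X\<^sub>n\<bar> \<longlonglongrightarrow> \<infinity>\<close> almost
  surely; bounded convergence then compares \<open>y x\<close> with the behaviour of \<open>y\<close> at infinity.\<close>

section \<open>The law of an i.i.d. sequence and its shift\<close>

text \<open>An i.i.d. sequence is one draw followed by an independent copy of the whole sequence. In
  this form Fubini can condition on the first letter.\<close>

lemma (in prob_space) stream_space_eq_distr_Stream:
  "stream_space M = distr (M \<Otimes>\<^sub>M stream_space M) (stream_space M) (\<lambda>(x, \<omega>). x ## \<omega>)"
proof (rule measure_eqI)
  interpret S: prob_space "stream_space M" by (rule prob_space_stream_space)
  fix A assume "A \<in> sets (stream_space M)"
  then have A[measurable]: "A \<in> sets (stream_space M)" .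
  show "emeasure (stream_space M) A
      = emeasure (distr (M \<Otimes>\<^sub>M stream_space M) (stream_space M) (\<lambda>(x, \<omega>). x ## \<omega>)) A"
    by (subst emeasure_distr, measurable, subst S.emeasure_pair_measure_alt, measurable,
        subst emeasure_stream_space)
       (auto intro!: nn_integral_cong arg_cong2[where f = emeasure] simp: space_pair_measure)
qed simp

lemma (in prob_space) integral_stream_space:
  fixes f :: "'a stream \<Rightarrow> real"
  assumes f: "integrable (stream_space M) f"
  shows "(\<integral>\<omega>. f \<omega> \<partial>stream_space M) = (\<integral>x. \<integral>\<omega>. f (x ## \<omega>) \<partial>stream_space M \<partial>M)"
proof -
  interpret S: prob_space "stream_space M" by (rule prob_space_stream_space)
  interpret pair_sigma_finite M "stream_space M" ..
  have [measurable]: "f \<in> borel_measurable (stream_space M)" using f by auto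
  have 1: "integrable (M \<Otimes>\<^sub>M stream_space M) (\<lambda>(x, \<omega>). f (x ## \<omega>))"
    using f by (subst (asm) stream_space_eq_distr_Stream, subst (asm) integrable_distr_eq)
      (auto simp: case_prod_unfold)
  show ?thesis
    using integral_fst'[OF 1]
    by (subst stream_space_eq_distr_Stream, subst integral_distr) (auto simp: case_prod_unfold)
qed

text \<open>A preimage under \<open>stl\<close> puts no constraint on the first letter, so
  integrating that letter out returns the measure unchanged.\<close>

lemma (in prob_space) distr_stl_stream_space:
  "distr (stream_space M) (stream_space M) stl = stream_space M"
proof (rule measure_eqI)
  interpret S: prob_space "stream_space M" by (rule prob_space_stream_space)
  fix A assume "A \<in> sets (distr (stream_space M) (stream_space M) stl)"
  then have A[measurable]: "A \<in> sets (stream_space M)" by simp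
  show "emeasure (distr (stream_space M) (stream_space M) stl) A = emeasure (stream_space M) A"
  proof -
    have "emeasure (distr (stream_space M) (stream_space M) stl) A
        = (\<integral>\<^sup>+x. emeasure (stream_space M) A \<partial>M)"
      using sets.sets_into_space[OF A]
      by (subst emeasure_distr, measurable, subst emeasure_stream_space, measurable)
        (auto simp: stream_space_Stream simp del: nn_integral_const
          intro!: nn_integral_cong arg_cong2[where f = emeasure])
    then show ?thesis by (simp add: emeasure_space_1)
  qed
qed simp

lemma (in prob_space)
  fixes f :: "'a stream \<Rightarrow> real"
  assumes [measurable]: "f \<in> borel_measurable (stream_space M)"
  shows integrable_stl_iff:
      "integrable (stream_space M) (\<lambda>\<omega>. f (stl \<omega>)) \<longleftrightarrow> integrable (stream_space M) f"
    and integral_stl: "(\<integral>\<omega>. f (stl \<omega>) \<partial>stream_space M) = (\<integral>\<omega>. f \<omega> \<partial>stream_space M)"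
  by (subst (2) distr_stl_stream_space[symmetric], subst integrable_distr_eq, simp_all)
    (subst (2) distr_stl_stream_space[symmetric], subst integral_distr, simp_all)

lemma (in prob_space) integrable_shd:
  fixes f :: "'a \<Rightarrow> real"
  assumes "integrable M f"
  shows "integrable (stream_space M) (\<lambda>\<omega>. f (shd \<omega>))"
proof -
  interpret S: prob_space "stream_space M" by (rule prob_space_stream_space)
  have [measurable]: "f \<in> borel_measurable M" using assms by auto
  interpret pair_sigma_finite M "stream_space M" ..
  have "integrable (M \<Otimes>\<^sub>M stream_space M) (\<lambda>(x, \<omega>). f x)"
    using assms by (intro Fubini_integrable) (auto intro: integrable_norm)
  then show ?thesis
    by (subst stream_space_eq_distr_Stream, subst integrable_distr_eq)
       (auto simp: case_prod_unfold)
qed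

section \<open>Running maxima of a random walk\<close>

text \<open>This is the maximum of the partial sums \<open>\<Sum>i<k. f (\<omega> !! i)\<close> over
  \<open>k \<le> n\<close>, the empty sum included. The recursion removes the first summand rather
  than the last, so that it relates \<open>\<omega>\<close> to \<open>stl \<omega>\<close>.\<close>

primrec walk_max :: "('a \<Rightarrow> real) \<Rightarrow> nat \<Rightarrow> 'a stream \<Rightarrow> real" where
  "walk_max f 0 \<omega> = 0"
| "walk_max f (Suc n) \<omega> = max 0 (f (shd \<omega>) + walk_max f n (stl \<omega>))"

lemma walk_max_nonneg: "0 \<le> walk_max f n \<omega>"
  by (cases n) auto

lemma walk_max_mono: "walk_max f n \<omega> \<le> walk_max f (Suc n) \<omega>"
proof (induction n arbitrary: \<omega>)
  case (Suc n)
  show ?case using Suc[of "stl \<omega>"] by (auto simp: max_def)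
qed simp

lemma incseq_walk_max: "incseq (\<lambda>n. walk_max f n \<omega>)"
  using walk_max_mono by (rule incseq_SucI)

lemma sum_le_walk_max: "(\<Sum>i<n. f (\<omega> !! i)) \<le> walk_max f n \<omega>"
proof (induction n arbitrary: \<omega>)
  case (Suc n)
  show ?case using Suc[of "stl \<omega>"] by (simp add: sum.lessThan_Suc_shift del: sum.lessThan_Suc)
qed simp

text \<open>The recursion converts a bound on either side into one on the other, at the cost of the
  single number \<open>f (shd \<omega>)\<close>. Boundedness of the maxima is therefore a
  shift-invariant event.\<close>

lemma bdd_above_walk_max_stl_iff:
  "bdd_above (range (\<lambda>n. walk_max f n (stl \<omega>))) \<longleftrightarrow> bdd_above (range (\<lambda>n. walk_max f n \<omega>))"
proof
  assume "bdd_above (range (\<lambda>n. walk_max f n (stl \<omega>)))"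
  then obtain C where C: "\<And>n. walk_max f n (stl \<omega>) \<le> C" by (auto simp: bdd_above_def)
  have "walk_max f n \<omega> \<le> max 0 (f (shd \<omega>) + C)" for n
    using C[of "n - 1"] by (cases n) (auto simp: max_def)
  then show "bdd_above (range (\<lambda>n. walk_max f n \<omega>))" by (auto simp: bdd_above_def)
next
  assume "bdd_above (range (\<lambda>n. walk_max f n \<omega>))"
  then obtain C where C: "\<And>n. walk_max f n \<omega> \<le> C" by (auto simp: bdd_above_def)
  have "walk_max f n (stl \<omega>) \<le> C - f (shd \<omega>)" for n
    using C[of "Suc n"] by auto
  then show "bdd_above (range (\<lambda>n. walk_max f n (stl \<omega>)))" by (auto simp: bdd_above_def)
qed

section \<open>Almost sure growth of sums and of single terms\<close>

context prob_space
begin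

lemma measurable_walk_max[measurable (raw)]:
  "f \<in> borel_measurable M \<Longrightarrow> g \<in> measurable N (stream_space M) \<Longrightarrow>
    (\<lambda>x. walk_max f n (g x)) \<in> borel_measurable N"
  by (induction n arbitrary: g) simp_all

lemma integrable_walk_max:
  assumes f: "integrable M f"
  shows "integrable (stream_space M) (walk_max f n)"
proof (induction n)
  case 0
  then show ?case by (simp add: fun_eq_iff)
next
  case (Suc n)
  have [measurable]: "f \<in> borel_measurable M" using f by auto
  have "integrable (stream_space M) (\<lambda>\<omega>. max 0 (f (shd \<omega>) + walk_max f n (stl \<omega>)))"
    by (intro integrable_max Bochner_Integration.integrable_add integrable_shd f
        integrable_stl_iff[THEN iffD2] Suc) auto
  then show ?case by (simp add: fun_eq_iff cong: Bochner_Integration.integrable_cong)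
qed

text \<open>On the shift-invariant event \<open>B\<close> that the maxima \<open>W n\<close> are unbounded, the increments
  \<open>W (n + 1) - W n \<circ> stl = max (- W n \<circ> stl) (f \<circ> shd)\<close> tend to \<open>f \<circ> shd\<close>, while their
  integrals over \<open>B\<close> equal those of \<open>W (n + 1) - W n \<ge> 0\<close>. Hence \<open>prob B * expectation f \<ge> 0\<close>.\<close>

lemma AE_bdd_above_walk_max:
  assumes f: "integrable M f" and neg: "expectation f < 0"
  shows "AE \<omega> in stream_space M. bdd_above (range (\<lambda>n. walk_max f n \<omega>))"
proof -
  interpret S: prob_space "stream_space M" by (rule prob_space_stream_space)
  interpret pair_sigma_finite M "stream_space M" ..
  have [measurable]: "f \<in> borel_measurable M" using f by auto
  define B where "B = {\<omega> \<in> space (stream_space M). \<not> bdd_above (range (\<lambda>n. walk_max f n \<omega>))}"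
  \<comment> \<open>Only integer bounds are tested, which exhibits \<open>B\<close> as a countable
    combination of measurable events.\<close>
  have B_eq: "B = {\<omega> \<in> space (stream_space M). \<forall>k::nat. \<exists>n. real k < walk_max f n \<omega>}"
  proof -
    have "(\<exists>C. \<forall>n. walk_max f n \<omega> \<le> C) \<longleftrightarrow> (\<exists>k::nat. \<forall>n. walk_max f n \<omega> \<le> real k)" for \<omega>
      by (meson order_trans real_arch_simple)
    then show ?thesis
      by (auto simp: B_def bdd_above_def simp flip: not_le)
  qed
  have B[measurable]: "B \<in> sets (stream_space M)"
    unfolding B_eq by measurable
  have stl_B: "indicator B (stl \<omega>) = (indicator B \<omega> :: real)" if "\<omega> \<in> space (stream_space M)" for \<omega>
    using that measurable_space[OF measurable_stl that]
    by (auto simp: B_def indicator_def bdd_above_walk_max_stl_iff)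
  define d where "d n \<omega> = indicator B \<omega> * max (- walk_max f n (stl \<omega>)) (f (shd \<omega>))" for n \<omega>
  have int: "integrable (stream_space M) (\<lambda>\<omega>. indicator B \<omega> * walk_max f n \<omega>)" for n
    using integrable_real_mult_indicator[OF B integrable_walk_max[OF f]] by (simp add: mult.commute)
  have d_nonneg: "0 \<le> (\<integral>\<omega>. d n \<omega> \<partial>stream_space M)" for n
  proof -
    have "(\<integral>\<omega>. d n \<omega> \<partial>stream_space M)
        = (\<integral>\<omega>. indicator B \<omega> * walk_max f (Suc n) \<omega>
             - indicator B (stl \<omega>) * walk_max f n (stl \<omega>) \<partial>stream_space M)"
      by (intro Bochner_Integration.integral_cong)
         (auto simp: d_def stl_B max_def algebra_simps)
    also have "\<dots> = (\<integral>\<omega>. indicator B \<omega> * walk_max f (Suc n) \<omega> \<partial>stream_space M)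
        - (\<integral>\<omega>. indicator B (stl \<omega>) * walk_max f n (stl \<omega>) \<partial>stream_space M)"
      using int[of n] integrable_stl_iff[of "\<lambda>\<omega>. indicator B \<omega> * walk_max f n \<omega>"]
      by (intro Bochner_Integration.integral_diff int) auto
    also have "\<dots> = (\<integral>\<omega>. indicator B \<omega> * walk_max f (Suc n) \<omega> \<partial>stream_space M)
        - (\<integral>\<omega>. indicator B \<omega> * walk_max f n \<omega> \<partial>stream_space M)"
      using integral_stl[of "\<lambda>\<omega>. indicator B \<omega> * walk_max f n \<omega>"] by simp
    also have "\<dots> \<ge> 0"
      using integral_mono[OF int int, of n "Suc n"] walk_max_mono[of f n]
      by (simp add: mult_left_mono)
    finally show ?thesis .
  qed
  have "(\<lambda>n. \<integral>\<omega>. d n \<omega> \<partial>stream_space M) \<longlonglongrightarrow> (\<integral>\<omega>. indicator B \<omega> * f (shd \<omega>) \<partial>stream_space M)"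
  proof (rule integral_dominated_convergence)
    show "integrable (stream_space M) (\<lambda>\<omega>. \<bar>f (shd \<omega>)\<bar>)"
      using integrable_shd[OF f] by auto
    show "AE \<omega> in stream_space M. (\<lambda>n. d n \<omega>) \<longlonglongrightarrow> indicator B \<omega> * f (shd \<omega>)"
    proof (rule AE_I2)
      fix \<omega> assume w: "\<omega> \<in> space (stream_space M)"
      show "(\<lambda>n. d n \<omega>) \<longlonglongrightarrow> indicator B \<omega> * f (shd \<omega>)"
      proof (cases "\<omega> \<in> B")
        case True
        then have "\<not> bdd_above (range (\<lambda>n. walk_max f n (stl \<omega>)))"
          by (auto simp: B_def bdd_above_walk_max_stl_iff)
        then obtain k where "walk_max f k (stl \<omega>) > - f (shd \<omega>)"
          by (auto simp: bdd_above_def not_le)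
        then have "d n \<omega> = indicator B \<omega> * f (shd \<omega>)" if "n \<ge> k" for n
          using incseqD[OF incseq_walk_max[of f "stl \<omega>"] that] by (auto simp: d_def max_def)
        then show ?thesis
          by (intro tendsto_eventually) (auto simp: eventually_sequentially)
      qed (simp add: d_def)
    qed
    show "AE \<omega> in stream_space M. norm (d n \<omega>) \<le> \<bar>f (shd \<omega>)\<bar>" for n
    proof -
      \<comment> \<open>Since \<open>- w \<le> 0\<close>, the maximum can only move a negative
        \<open>r\<close> towards 0; this gives the dominating function.\<close>
      have "\<bar>max (- w) r\<bar> \<le> \<bar>r\<bar>" if "0 \<le> w" for w r :: real
        using that by linarith
      then show ?thesis
        by (intro AE_I2) (auto simp: d_def indicator_def walk_max_nonneg)
    qed
  qed (auto simp: d_def)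
  then have "0 \<le> (\<integral>\<omega>. indicator B \<omega> * f (shd \<omega>) \<partial>stream_space M)"
    using d_nonneg by (intro LIMSEQ_le_const) auto
  \<comment> \<open>By shift invariance \<open>B\<close> can be read off the tail, which is
    independent of the first letter, so the integral factorises.\<close>
  also have "\<dots> = (\<integral>\<omega>. indicator B (stl \<omega>) * f (shd \<omega>) \<partial>stream_space M)"
    by (intro Bochner_Integration.integral_cong) (auto simp: stl_B)
  also have "\<dots> = (\<integral>x. \<integral>\<omega>. indicator B \<omega> * f x \<partial>stream_space M \<partial>M)"
  proof -
    have "integrable (stream_space M) (\<lambda>\<omega>. indicator B (stl \<omega>) * f (shd \<omega>))"
      by (rule Bochner_Integration.integrable_bound[OF integrable_shd[OF f]])
        (auto simp: indicator_def)
    from integral_stream_space[OF this] show ?thesis by simp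
  qed
  also have "\<dots> = expectation f * S.prob B"
    by simp
  finally have "S.prob B = 0"
    using neg measure_nonneg[of "stream_space M" B] by (simp add: zero_le_mult_iff)
  then have "AE \<omega> in stream_space M. \<omega> \<notin> B"
    by (simp add: S.prob_eq_0)
  with AE_space show ?thesis
    by eventually_elim (auto simp: B_def)
qed

text \<open>The upper half of the strong law of large numbers, with a constant depending on the
  path: \<open>f - c\<close> has negative mean, so its walk is almost surely bounded above.\<close>

lemma AE_sum_snth_le:
  assumes f: "integrable M f" and less: "expectation f < c"
  shows "AE \<omega> in stream_space M. \<exists>C. \<forall>n. (\<Sum>i<n. f (\<omega> !! i)) \<le> C + c * real n"
proof -
  have "AE \<omega> in stream_space M. bdd_above (range (\<lambda>n. walk_max (\<lambda>x. f x - c) n \<omega>))"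
    using f less by (intro AE_bdd_above_walk_max) (auto simp: prob_space)
  then show ?thesis
  proof eventually_elim
    case (elim \<omega>)
    then obtain C where "\<And>n. walk_max (\<lambda>x. f x - c) n \<omega> \<le> C" by (auto simp: bdd_above_def)
    then have "(\<Sum>i<n. f (\<omega> !! i) - c) \<le> C" for n
      by (rule order_trans[OF sum_le_walk_max])
    then have "(\<Sum>i<n. f (\<omega> !! i)) \<le> C + c * real n" for n
      by (simp add: sum_subtractf algebra_simps)
    then show ?case by blast
  qed
qed

text \<open>Truncation makes the expectation of \<open>max 0 (f - L)\<close> smaller than \<open>\<epsilon>\<close>, after which a single
  summand is dominated by the whole sum; this replaces a Borel--Cantelli argument.\<close>

lemma AE_snth_le_linear:
  assumes f: "integrable M f" and "0 < \<epsilon>"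
  shows "AE \<omega> in stream_space M. \<exists>C. \<forall>n. f (\<omega> !! n) \<le> C + \<epsilon> * real n"
proof -
  have [measurable]: "f \<in> borel_measurable M" using f by auto
  have "(\<lambda>L. \<integral>x. max 0 (f x - real L) \<partial>M) \<longlonglongrightarrow> (\<integral>x. 0 \<partial>M)"
  proof (rule integral_dominated_convergence)
    show "AE x in M. (\<lambda>L. max 0 (f x - real L)) \<longlonglongrightarrow> 0"
    proof (rule AE_I2)
      fix x
      obtain k where "f x < real k" using reals_Archimedean2 by blast
      then have "max 0 (f x - real L) = 0" if "L \<ge> k" for L
        using that by (auto simp: max_def)
      then show "(\<lambda>L. max 0 (f x - real L)) \<longlonglongrightarrow> 0"
        by (intro tendsto_eventually) (auto simp: eventually_sequentially)
    qed
    show "integrable M (\<lambda>x. \<bar>f x\<bar>)" using f by auto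
  qed auto
  then have "\<forall>\<^sub>F L in sequentially. (\<integral>x. max 0 (f x - real L) \<partial>M) < \<epsilon>"
    using \<open>0 < \<epsilon>\<close> by (intro order_tendstoD) auto
  then obtain L where L: "(\<integral>x. max 0 (f x - real L) \<partial>M) < \<epsilon>"
    by (auto simp: eventually_sequentially)
  have "AE \<omega> in stream_space M.
      \<exists>C. \<forall>n. (\<Sum>i<n. max 0 (f (\<omega> !! i) - real L)) \<le> C + \<epsilon> * real n"
    using f L by (intro AE_sum_snth_le) auto
  then show ?thesis
  proof eventually_elim
    case (elim \<omega>)
    then obtain C where C: "\<And>n. (\<Sum>i<n. max 0 (f (\<omega> !! i) - real L)) \<le> C + \<epsilon> * real n" by blast
    \<comment> \<open>The term of index \<open>n\<close> occurs in the sum of length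
      \<open>Suc n\<close>, whence the extra \<open>\<epsilon>\<close>; adding \<open>real L\<close>
      undoes the truncation.\<close>
    have "f (\<omega> !! n) \<le> (C + \<epsilon> + real L) + \<epsilon> * real n" for n
    proof -
      have "0 \<le> (\<Sum>i<n. max 0 (f (\<omega> !! i) - real L))" by (intro sum_nonneg) auto
      then have "max 0 (f (\<omega> !! n) - real L) \<le> C + \<epsilon> * real (Suc n)"
        using C[of "Suc n"] unfolding sum.lessThan_Suc by linarith
      then show ?thesis by (simp add: algebra_simps)
    qed
    then show ?case by blast
  qed
qed

end

section \<open>Atoms of a real random variable\<close>

text \<open>Distinct points carry disjoint events, so their masses add up to at most 1 and no more
  than \<open>1 / q\<close> of them can weigh \<open>q\<close> or more.\<close>

lemma (in prob_space) finite_large_atoms: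
  fixes Z :: "'a \<Rightarrow> real"
  assumes [measurable]: "Z \<in> borel_measurable M" and "(0::real) < q"
  shows "finite {z. q \<le> expectation (\<lambda>\<omega>. indicator {z} (Z \<omega>))}"
proof (rule finite_if_finite_subsets_card_bdd[where C = "nat \<lfloor>1 / q\<rfloor>", THEN conjunct1])
  fix K assume K: "K \<subseteq> {z. q \<le> expectation (\<lambda>\<omega>. indicator {z} (Z \<omega>))}" "finite K"
  have "real (card K) * q \<le> (\<Sum>z\<in>K. expectation (\<lambda>\<omega>. indicator {z} (Z \<omega>)))"
    using K sum_bounded_below[of K q] by (auto simp: subset_iff)
  also have "\<dots> = expectation (\<lambda>\<omega>. \<Sum>z\<in>K. indicator {z} (Z \<omega>))"
    by (intro Bochner_Integration.integral_sum[symmetric] integrable_const_bound[where B = 1]) auto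
  also have "\<dots> = expectation (\<lambda>\<omega>. indicator K (Z \<omega>))"
    using K by (intro Bochner_Integration.integral_cong)
      (auto simp: indicator_def sum.delta of_bool_def)
  also have "\<dots> \<le> expectation (\<lambda>\<omega>. 1)"
  proof (intro integral_mono integrable_const_bound[where B = 1])
    have [measurable]: "K \<in> sets borel"
      using K by (intro borel_closed finite_imp_closed)
    show "(\<lambda>\<omega>. indicator K (Z \<omega>) :: real) \<in> borel_measurable M" by measurable
  qed (auto simp: indicator_def)
  finally have "real (card K) \<le> 1 / q"
    using \<open>0 < q\<close> by (simp add: prob_space field_simps)
  then show "card K \<le> nat \<lfloor>1 / q\<rfloor>" by linarith
qed

section \<open>The affine recursion along a fixed coefficient sequence\<close>

type_synonym coeffs = "(real \<times> real) stream"

primrec coeff_prod :: "nat \<Rightarrow> coeffs \<Rightarrow> real" where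
  "coeff_prod 0 \<omega> = 1"
| "coeff_prod (Suc n) \<omega> = fst (shd \<omega>) * coeff_prod n (stl \<omega>)"

text \<open>The head of the stream acts on \<open>x\<close> first, so that splitting off the first
  letter corresponds to one use of the functional equation.\<close>

primrec orbit :: "nat \<Rightarrow> real \<Rightarrow> coeffs \<Rightarrow> real" where
  "orbit 0 x \<omega> = x"
| "orbit (Suc n) x \<omega> = orbit n (fst (shd \<omega>) * (x - snd (shd \<omega>))) (stl \<omega>)"

definition perp_term :: "coeffs \<Rightarrow> nat \<Rightarrow> real" where
  "perp_term \<omega> k = snd (\<omega> !! k) / coeff_prod k \<omega>"

text \<open>The series \<open>Z\<close> of the overview. Where it diverges the value of
  \<open>suminf\<close> is arbitrary; \<open>AE_good_coeffs\<close> shows that this is a null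
  event.\<close>

definition perpetuity :: "coeffs \<Rightarrow> real" where
  "perpetuity \<omega> = (\<Sum>k. perp_term \<omega> k)"

lemma coeff_prod_eq_prod: "coeff_prod n \<omega> = (\<Prod>i<n. fst (\<omega> !! i))"
  by (induction n arbitrary: \<omega>) (simp_all add: prod.lessThan_Suc_shift del: prod.lessThan_Suc)

lemma perp_term_0 [simp]: "perp_term \<omega> 0 = snd (shd \<omega>)"
  by (simp add: perp_term_def)

lemma perp_term_Suc: "perp_term \<omega> (Suc k) = perp_term (stl \<omega>) k / fst (shd \<omega>)"
  by (simp add: perp_term_def)

text \<open>Factoring the product out of the unrolled recursion leaves partial sums that do not
  depend on \<open>x\<close>, so one series governs the orbits of all starting points.\<close>

lemma orbit_eq:
  assumes "\<And>i. fst (\<omega> !! i) \<noteq> 0"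
  shows "orbit n x \<omega> = coeff_prod n \<omega> * (x - (\<Sum>k<n. perp_term \<omega> k))"
  using assms
proof (induction n arbitrary: x \<omega>)
  case (Suc n)
  have "fst (stl \<omega> !! i) \<noteq> 0" for i using Suc.prems[of "Suc i"] by simp
  note IH = Suc.IH[OF this]
  have "fst (shd \<omega>) \<noteq> 0" using Suc.prems[of 0] by simp
  then show ?case
    by (simp add: IH sum.lessThan_Suc_shift perp_term_Suc sum_divide_distrib[symmetric] field_simps
        del: sum.lessThan_Suc)
qed simp

text \<open>Every term after the first carries the factor \<open>1 / a\<close>. For
  \<open>a \<noteq> 0\<close> the new value is \<open>z\<close> exactly when the old one is
  \<open>a * (z - b)\<close>, which is the map of the functional equation.\<close>

lemma perpetuity_Stream:
  assumes "summable (perp_term \<omega>)"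
  shows "perpetuity ((a, b) ## \<omega>) = b + perpetuity \<omega> / a"
proof -
  have "(\<lambda>k. perp_term ((a, b) ## \<omega>) (Suc k)) sums (perpetuity \<omega> / a)"
    using assms by (simp add: perp_term_Suc perpetuity_def sums_divide summable_sums)
  from sums_Suc[OF this] show ?thesis
    by (simp add: perpetuity_def sums_iff)
qed

text \<open>In \<open>orbit_eq\<close> the second factor tends to the nonzero number
  \<open>x - perpetuity \<omega>\<close>, while the first tends to infinity in modulus.\<close>

lemma abs_orbit_tendsto_at_top:
  assumes nz: "\<And>i. fst (\<omega> !! i) \<noteq> 0"
    and "filterlim (\<lambda>n. \<bar>coeff_prod n \<omega>\<bar>) at_top sequentially"
    and "summable (perp_term \<omega>)" and "perpetuity \<omega> \<noteq> x"
  shows "filterlim (\<lambda>n. \<bar>orbit n x \<omega>\<bar>) at_top sequentially"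
proof -
  have "(\<lambda>n. \<bar>x - (\<Sum>k<n. perp_term \<omega> k)\<bar>) \<longlonglongrightarrow> \<bar>x - perpetuity \<omega>\<bar>"
    using assms(3) unfolding perpetuity_def by (intro tendsto_intros summable_LIMSEQ)
  from filterlim_tendsto_pos_mult_at_top[OF this _ assms(2)] show ?thesis
    using assms(4) unfolding orbit_eq[OF nz] abs_mult by (simp add: mult.commute)
qed

text \<open>Denominators growing at rate \<open>c\<close> against numerators at rate
  \<open>c / 2\<close> leave a geometric series of ratio \<open>exp (- (c / 2))\<close>.\<close>

lemma summable_perp_term:
  assumes "0 < c"
    and A: "\<And>n. exp (c * real n - C) \<le> \<bar>coeff_prod n \<omega>\<bar>"
    and b: "\<And>n. \<bar>snd (\<omega> !! n)\<bar> \<le> exp (D + c / 2 * real n)"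
  shows "summable (perp_term \<omega>)"
proof (rule summable_comparison_test)
  have "norm (perp_term \<omega> n) \<le> exp (C + D) * exp (- (c / 2)) ^ n" for n
  proof -
    have "norm (perp_term \<omega> n) \<le> exp (D + c / 2 * real n) / exp (c * real n - C)"
      unfolding perp_term_def real_norm_def abs_divide
      by (intro frac_le A b) auto
    also have "\<dots> = exp (C + D) * exp (- (c / 2)) ^ n"
      by (simp add: exp_of_nat_mult[symmetric] exp_add[symmetric] exp_diff[symmetric] field_simps)
    finally show ?thesis .
  qed
  then show "\<exists>N. \<forall>n\<ge>N. norm (perp_term \<omega> n) \<le> exp (C + D) * exp (- (c / 2)) ^ n" by blast
  show "summable (\<lambda>n. exp (C + D) * exp (- (c / 2)) ^ n)"
    using \<open>0 < c\<close> by (intro summable_mult summable_geometric) auto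
qed

section \<open>Divergence of the random affine recursion\<close>

text \<open>\<open>N\<close> stands for the joint law of the coefficient pair, so that independent
  copies of the pair are the letters of a stream. Within a letter the two coordinates may be
  dependent.\<close>

locale supercritical_affine = prob_space N for N :: "(real \<times> real) measure" +
  assumes sets_N [measurable_cong]: "sets N = sets borel"
    and AE_fst_nonzero: "AE p in N. fst p \<noteq> 0"
    and integrable_ln_fst: "integrable N (\<lambda>p. ln \<bar>fst p\<bar>)"
    and expectation_ln_fst_pos: "0 < expectation (\<lambda>p. ln \<bar>fst p\<bar>)"
    and integrable_ln_snd: "integrable N (\<lambda>p. ln (max \<bar>snd p\<bar> 1))"
    and no_fixed_point: "\<not> (AE p in N. fst p * (c - snd p) = c)"
begin

sublocale S: prob_space "stream_space N"
  by (rule prob_space_stream_space)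

lemma measurable_fst_N [measurable]: "fst \<in> borel_measurable N"
  and measurable_snd_N [measurable]: "snd \<in> borel_measurable N"
  by (simp_all cong: measurable_cong_sets add: borel_measurable_continuous_onI sets_N
      continuous_on_fst continuous_on_snd)

lemma measurable_coeff_prod [measurable]:
  "coeff_prod n \<in> borel_measurable (stream_space N)"
  unfolding coeff_prod_eq_prod[abs_def] by measurable

lemma measurable_perpetuity [measurable]: "perpetuity \<in> borel_measurable (stream_space N)"
  unfolding perpetuity_def[abs_def] perp_term_def by measurable

lemma measurable_orbit_pair:
  "f \<in> borel_measurable K \<Longrightarrow> g \<in> measurable K (stream_space N) \<Longrightarrow>
    (\<lambda>x. orbit n (f x) (g x)) \<in> borel_measurable K"
  by (induction n arbitrary: f g) simp_all

lemma AE_good_coeffs: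
  "AE \<omega> in stream_space N. (\<forall>i. fst (\<omega> !! i) \<noteq> 0)
    \<and> filterlim (\<lambda>n. \<bar>coeff_prod n \<omega>\<bar>) at_top sequentially \<and> summable (perp_term \<omega>)"
proof -
  \<comment> \<open>Half the mean of \<open>ln \<bar>fst p\<bar>\<close>: positive, yet strictly
    below the mean as \<open>AE_sum_snth_le\<close> requires.\<close>
  define c where "c = expectation (\<lambda>p. ln \<bar>fst p\<bar>) / 2"
  have c: "0 < c" "c < expectation (\<lambda>p. ln \<bar>fst p\<bar>)"
    using expectation_ln_fst_pos by (auto simp: c_def)
  have "AE \<omega> in stream_space N. stream_all (\<lambda>p. fst p \<noteq> 0) \<omega>"
    by (intro AE_stream_all AE_fst_nonzero) measurable
  \<comment> \<open>The upper bound for the negated logarithms is a lower bound for the products, of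
    exponential rate \<open>c\<close>.\<close>
  moreover have "AE \<omega> in stream_space N.
      \<exists>C. \<forall>n. (\<Sum>i<n. - ln \<bar>fst (\<omega> !! i)\<bar>) \<le> C + - c * real n"
    using c integrable_ln_fst by (intro AE_sum_snth_le) auto
  \<comment> \<open>The rate \<open>c / 2\<close> keeps the numerators of the series below the
    products.\<close>
  moreover have "AE \<omega> in stream_space N.
      \<exists>D. \<forall>n. ln (max \<bar>snd (\<omega> !! n)\<bar> 1) \<le> D + c / 2 * real n"
    using c integrable_ln_snd by (intro AE_snth_le_linear) auto
  ultimately show ?thesis
  proof eventually_elim
    case (elim \<omega>)
    then obtain C D where
      C: "\<And>n. (\<Sum>i<n. - ln \<bar>fst (\<omega> !! i)\<bar>) \<le> C + - c * real n" and
      D: "\<And>n. ln (max \<bar>snd (\<omega> !! n)\<bar> 1) \<le> D + c / 2 * real n" by blast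
    have nz: "fst (\<omega> !! i) \<noteq> 0" for i
      using elim(1) by (simp add: stream_all_def)
    have A: "exp (c * real n - C) \<le> \<bar>coeff_prod n \<omega>\<bar>" for n
    proof -
      have "\<bar>coeff_prod n \<omega>\<bar> = exp (\<Sum>i<n. ln \<bar>fst (\<omega> !! i)\<bar>)"
        using nz by (simp add: coeff_prod_eq_prod abs_prod exp_sum)
      then show ?thesis
        using C[of n] by (simp add: sum_negf)
    qed
    have b: "\<bar>snd (\<omega> !! n)\<bar> \<le> exp (D + c / 2 * real n)" for n
    proof -
      have "\<bar>snd (\<omega> !! n)\<bar> \<le> exp (ln (max \<bar>snd (\<omega> !! n)\<bar> 1))"
        by (subst exp_ln) auto
      also have "\<dots> \<le> exp (D + c / 2 * real n)" using D by (simp only: exp_le_cancel_iff)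
      finally show ?thesis .
    qed
    have "summable (perp_term \<omega>)" by (rule summable_perp_term[OF \<open>0 < c\<close> A b])
    moreover have "filterlim (\<lambda>n. exp (c * real n - C)) at_top sequentially"
      using \<open>0 < c\<close>
      unfolding diff_conv_add_uminus add.commute[of _ "- C"]
      by (intro filterlim_compose[OF exp_at_top] filterlim_tendsto_add_at_top[OF tendsto_const]
          filterlim_tendsto_pos_mult_at_top[OF tendsto_const] filterlim_real_sequentially)
    then have "filterlim (\<lambda>n. \<bar>coeff_prod n \<omega>\<bar>) at_top sequentially"
      by (rule filterlim_at_top_mono) (simp add: A)
    ultimately show ?case using nz by simp
  qed
qed

section \<open>The law of the perpetuity has no atoms\<close>

text \<open>Writing the point mass as the integral of an indicator makes measurability in
  \<open>z\<close> and conditioning on the first letter instances of Fubini.\<close>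

definition atom :: "real \<Rightarrow> real" where
  "atom z = S.expectation (\<lambda>\<omega>. indicator {z} (perpetuity \<omega>))"

lemma measurable_atom [measurable]: "atom \<in> borel_measurable borel"
  unfolding atom_def[abs_def] indicator_def[abs_def] singleton_iff by measurable

lemma atom_nonneg: "0 \<le> atom z" and atom_le_1: "atom z \<le> 1"
proof -
  show "0 \<le> atom z" unfolding atom_def by (intro Bochner_Integration.integral_nonneg) auto
  have "atom z \<le> S.expectation (\<lambda>\<omega>. 1)"
    unfolding atom_def by (intro integral_mono S.integrable_const_bound[where B = 1]) auto
  then show "atom z \<le> 1" by (simp add: S.prob_space)
qed

text \<open>The point masses solve the same functional equation as \<open>y\<close>: given the first
  letter \<open>p\<close>, the perpetuity hits \<open>z\<close> exactly when that of the tail hits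
  \<open>fst p * (z - snd p)\<close>.\<close>

lemma atom_eq: "atom z = expectation (\<lambda>p. atom (fst p * (z - snd p)))"
proof -
  have "atom z = expectation (\<lambda>p. S.expectation (\<lambda>\<omega>. indicator {z} (perpetuity (p ## \<omega>))))"
    unfolding atom_def
    by (intro integral_stream_space S.integrable_const_bound[where B = 1]) auto
  also have "\<dots> = expectation (\<lambda>p. atom (fst p * (z - snd p)))"
  proof (rule integral_cong_AE)
    show "AE p in N. S.expectation (\<lambda>\<omega>. indicator {z} (perpetuity (p ## \<omega>)))
        = atom (fst p * (z - snd p))"
      using AE_fst_nonzero AE_space
    proof eventually_elim
      case (elim p)
      have "AE \<omega> in stream_space N. indicator {z} (perpetuity (p ## \<omega>))
          = (indicator {fst p * (z - snd p)} (perpetuity \<omega>) :: real)"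
        using AE_good_coeffs
      proof eventually_elim
        case (elim \<omega>)
        then have "perpetuity (p ## \<omega>) = snd p + perpetuity \<omega> / fst p"
          using perpetuity_Stream[of \<omega> "fst p" "snd p"] by simp
        then show ?case
          using \<open>fst p \<noteq> 0\<close> by (auto simp: indicator_def field_simps)
      qed
      then show ?case
        using elim unfolding atom_def by (intro integral_cong_AE) auto
    qed
  qed auto
  finally show ?thesis .
qed

text \<open>Almost every map \<open>z \<mapsto> a * (z - b)\<close> permutes the finite set of atoms of maximal mass, hence
  fixes their centroid.\<close>

lemma atom_eq_0: "atom z = 0"
proof (rule ccontr)
  assume "atom z \<noteq> 0"
  then have "0 < atom z" using atom_nonneg[of z] by simp
  have fin: "finite {w. atom z \<le> atom w}"
    unfolding atom_def using \<open>0 < atom z\<close>[unfolded atom_def] by (rule S.finite_large_atoms[rotated]) simp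
  \<comment> \<open>The largest mass is attained, because only finitely many points weigh at least
    as much as \<open>z\<close>.\<close>
  define p where "p = Max (atom ` {w. atom z \<le> atom w})"
  have le_p: "atom w \<le> p" for w
  proof (cases "atom z \<le> atom w")
    case True
    then show ?thesis unfolding p_def using fin by (intro Max_ge) auto
  next
    case False
    moreover have "atom z \<le> p" unfolding p_def using fin by (intro Max_ge) auto
    ultimately show ?thesis by simp
  qed
  define F where "F = {w. atom w = p}"
  have "p \<in> atom ` {w. atom z \<le> atom w}"
    unfolding p_def using fin by (intro Max_in) auto
  then have "F \<noteq> {}" by (auto simp: F_def)
  have "finite F"
    by (rule finite_subset[OF _ fin]) (use le_p[of z] in \<open>auto simp: F_def\<close>)
  \<comment> \<open>By \<open>atom_eq\<close> the maximal mass \<open>p\<close> is an average of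
    masses that are all at most \<open>p\<close>, so almost all of them equal
    \<open>p\<close>.\<close>
  have "AE q in N. fst q * (w - snd q) \<in> F" if "w \<in> F" for w
  proof -
    have int: "integrable N (\<lambda>q. atom (fst q * (w - snd q)))"
      by (intro integrable_const_bound[where B = 1]) (auto simp: atom_nonneg atom_le_1)
    have "expectation (\<lambda>q. p - atom (fst q * (w - snd q))) = 0"
      using that int by (simp add: F_def prob_space flip: atom_eq)
    then have "AE q in N. p - atom (fst q * (w - snd q)) = 0"
      using int le_p by (subst (asm) integral_nonneg_eq_0_iff_AE) auto
    then show ?thesis by eventually_elim (simp add: F_def)
  qed
  then have "AE q in N. \<forall>w\<in>F. fst q * (w - snd q) \<in> F"
    using \<open>finite F\<close> by (intro AE_finite_allI) auto
  then have "AE q in N. fst q * (\<Sum>F / card F - snd q) = \<Sum>F / card F"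
    using AE_fst_nonzero
  proof eventually_elim
    case (elim q)
    have "inj_on (\<lambda>w. fst q * (w - snd q)) F"
      using elim(2) by (auto simp: inj_on_def)
    moreover from this have "(\<lambda>w. fst q * (w - snd q)) ` F = F"
      using elim(1) \<open>finite F\<close> by (intro endo_inj_surj) auto
    ultimately have "(\<Sum>w\<in>F. fst q * (w - snd q)) = \<Sum>F"
      using sum.reindex[of "\<lambda>w. fst q * (w - snd q)" F "\<lambda>w. w"] by simp
    then have "fst q * (\<Sum>F - card F * snd q) = \<Sum>F"
      by (simp add: sum_distrib_left[symmetric] sum_subtractf)
    then show ?case
      using \<open>finite F\<close> \<open>F \<noteq> {}\<close> by (simp add: field_simps card_gt_0_iff)
  qed
  with no_fixed_point show False by blast
qed

lemma AE_perpetuity_neq: "AE \<omega> in stream_space N. perpetuity \<omega> \<noteq> x"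
proof -
  have "AE \<omega> in stream_space N. indicator {x} (perpetuity \<omega>) = (0 :: real)"
    using atom_eq_0[of x] unfolding atom_def
    by (subst (asm) integral_nonneg_eq_0_iff_AE)
      (auto intro!: S.integrable_const_bound[where B = 1])
  then show ?thesis by eventually_elim (auto simp: indicator_def)
qed

lemma AE_abs_orbit_tendsto_at_top:
  "AE \<omega> in stream_space N. filterlim (\<lambda>n. \<bar>orbit n x \<omega>\<bar>) at_top sequentially"
  using AE_good_coeffs AE_perpetuity_neq[of x]
  by eventually_elim (auto intro: abs_orbit_tendsto_at_top)

section \<open>Bounded solutions along the orbit\<close>

text \<open>Conditioning on the first letter moves the starting point to
  \<open>fst p * (x - snd p)\<close>. There the induction hypothesis applies, and the equation for
  \<open>y\<close> then closes the step.\<close>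

lemma expectation_orbit:
  fixes y :: "real \<Rightarrow> real"
  assumes [measurable]: "y \<in> borel_measurable borel" and bd: "\<And>x. \<bar>y x\<bar> \<le> K"
    and y: "\<And>x. y x = expectation (\<lambda>p. y (fst p * (x - snd p)))"
  shows "y x = S.expectation (\<lambda>\<omega>. y (orbit n x \<omega>))"
proof (induction n arbitrary: x)
  case 0
  show ?case by (simp add: S.prob_space)
next
  case (Suc n)
  note measurable_orbit_pair [measurable]
  have "S.expectation (\<lambda>\<omega>. y (orbit (Suc n) x \<omega>))
      = expectation (\<lambda>p. S.expectation (\<lambda>\<omega>. y (orbit (Suc n) x (p ## \<omega>))))"
    by (intro integral_stream_space S.integrable_const_bound[where B = K]) (auto simp: bd)
  also have "\<dots> = expectation (\<lambda>p. y (fst p * (x - snd p)))"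
    by (simp flip: Suc)
  finally show ?case by (simp flip: y)
qed

text \<open>The orbit leaves every bounded set, but its sign is not controlled; this is why the
  bound \<open>r\<close> is assumed at both ends of the line.\<close>

lemma solution_ge:
  fixes y :: "real \<Rightarrow> real"
  assumes [measurable]: "y \<in> borel_measurable borel" and bd: "\<And>x. \<bar>y x\<bar> \<le> K"
    and y: "\<And>x. y x = expectation (\<lambda>p. y (fst p * (x - snd p)))"
    and r: "eventually (\<lambda>t. r \<le> y t) at_top" "eventually (\<lambda>t. r \<le> y t) at_bot"
  shows "r \<le> y x"
proof -
  note measurable_orbit_pair [measurable]
  obtain T where T: "\<And>t. T \<le> \<bar>t\<bar> \<Longrightarrow> r \<le> y t"
  proof -
    obtain T1 T2 where T12: "\<And>t. T1 \<le> t \<Longrightarrow> r \<le> y t" "\<And>t. t \<le> T2 \<Longrightarrow> r \<le> y t"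
      using r by (auto simp: eventually_at_top_linorder eventually_at_bot_linorder)
    show ?thesis
    proof (rule that[of "max T1 (- T2)"])
      fix t assume "max T1 (- T2) \<le> \<bar>t\<bar>"
      then have "T1 \<le> t \<or> t \<le> T2" by linarith
      then show "r \<le> y t" using T12 by blast
    qed
  qed
  \<comment> \<open>The values of \<open>y\<close> along the orbit need not converge. Cut off at
    \<open>r\<close>, they are almost surely equal to \<open>r\<close> from some index on.\<close>
  have "(\<lambda>n. S.expectation (\<lambda>\<omega>. min r (y (orbit n x \<omega>)))) \<longlonglongrightarrow> S.expectation (\<lambda>\<omega>. r)"
  proof (rule integral_dominated_convergence)
    show "AE \<omega> in stream_space N. (\<lambda>n. min r (y (orbit n x \<omega>))) \<longlonglongrightarrow> r"
      using AE_abs_orbit_tendsto_at_top[of x]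
    proof eventually_elim
      case (elim \<omega>)
      then have "\<forall>\<^sub>F n in sequentially. T \<le> \<bar>orbit n x \<omega>\<bar>"
        by (simp add: filterlim_at_top)
      then show ?case
        by (intro tendsto_eventually) (auto elim!: eventually_mono intro!: min_absorb1 T)
    qed
    show "AE \<omega> in stream_space N. norm (min r (y (orbit n x \<omega>))) \<le> \<bar>r\<bar> + K" for n
    proof (intro AE_I2)
      fix \<omega> show "norm (min r (y (orbit n x \<omega>))) \<le> \<bar>r\<bar> + K"
        using bd[of "orbit n x \<omega>"] by (auto simp: min_def)
    qed
  qed auto
  moreover have "S.expectation (\<lambda>\<omega>. min r (y (orbit n x \<omega>))) \<le> y x" for n
  proof -
    have int: "integrable (stream_space N) (\<lambda>\<omega>. y (orbit n x \<omega>))"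
      by (intro S.integrable_const_bound[where B = K]) (auto simp: bd)
    have "S.expectation (\<lambda>\<omega>. min r (y (orbit n x \<omega>))) \<le> S.expectation (\<lambda>\<omega>. y (orbit n x \<omega>))"
      using int by (intro integral_mono integrable_min) auto
    then show ?thesis using expectation_orbit[OF assms(1-3), of x n] by simp
  qed
  ultimately show ?thesis
    by (intro LIMSEQ_le_const2[where X = "\<lambda>n. S.expectation (\<lambda>\<omega>. min r (y (orbit n x \<omega>)))"])
      (auto simp: S.prob_space)
qed

text \<open>Otherwise some real \<open>r\<close> lies strictly between \<open>y x\<close> and both
  lower limits; \<open>y\<close> then exceeds \<open>r\<close> near both ends, and
  \<open>solution_ge\<close> gives a contradiction.\<close>

lemma min_Liminf_le_solution:
  fixes y :: "real \<Rightarrow> real"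
  assumes "y \<in> borel_measurable borel" and "\<And>x. \<bar>y x\<bar> \<le> K"
    and "\<And>x. y x = expectation (\<lambda>p. y (fst p * (x - snd p)))"
  shows "min (Liminf at_top (\<lambda>t. ereal (y t))) (Liminf at_bot (\<lambda>t. ereal (y t))) \<le> ereal (y x)"
proof (rule ccontr)
  assume "\<not> ?thesis"
  then obtain r where r: "ereal (y x) < ereal r"
    "ereal r < min (Liminf at_top (\<lambda>t. ereal (y t))) (Liminf at_bot (\<lambda>t. ereal (y t)))"
    using ereal_dense2 by (metis linorder_not_le)
  then have "eventually (\<lambda>t. r < y t) at_top" "eventually (\<lambda>t. r < y t) at_bot"
    by (auto dest!: less_LiminfD)
  then have "r \<le> y x"
    by (intro solution_ge[OF assms]) (auto elim: eventually_mono)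
  with r show False by simp
qed

end

section \<open>Transfer to the joint law of the coefficients\<close>

theorem theorem4p1:
  fixes P :: "'a measure" and \<alpha> \<beta> :: "'a \<Rightarrow> real" and y :: "real \<Rightarrow> real"
  assumes "prob_space P"
    and "(\<lambda>\<omega>. (\<alpha> \<omega>, \<beta> \<omega>)) \<in> borel_measurable P"
    and "\<P>(\<omega> in P. \<alpha> \<omega> \<noteq> 0) = 1"
    and "\<P>(\<omega> in P. \<bar>\<alpha> \<omega>\<bar> \<noteq> 1) > 0"
    and "\<forall>c::real. \<P>(\<omega> in P. \<alpha> \<omega> * (c - \<beta> \<omega>) = c) < 1"
    and "integrable P (\<lambda>\<omega>. ln \<bar>\<alpha> \<omega>\<bar>)"
    and "0 < (\<integral>\<omega>. ln \<bar>\<alpha> \<omega>\<bar> \<partial>P)"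
    and "integrable P (\<lambda>\<omega>. ln (max \<bar>\<beta> \<omega>\<bar> 1))"
    and "bounded_solution P \<alpha> \<beta> y"
  shows "\<forall>x. min (Liminf at_top (\<lambda>t. ereal (y t))) (Liminf at_bot (\<lambda>t. ereal (y t))) \<le> ereal (y x) \<and>
             ereal (y x) \<le> max (Limsup at_top (\<lambda>t. ereal (y t))) (Limsup at_bot (\<lambda>t. ereal (y t)))"
proof
  fix x
  interpret P: prob_space P by fact
  define N where "N = distr P borel (\<lambda>\<omega>. (\<alpha> \<omega>, \<beta> \<omega>))"
  note pair [measurable] = assms(2)
  have [measurable]: "fst \<in> borel_measurable (borel :: (real \<times> real) measure)"
    "snd \<in> borel_measurable (borel :: (real \<times> real) measure)"
    by (simp_all add: borel_measurable_continuous_onI continuous_on_fst continuous_on_snd)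
  have [measurable]: "\<alpha> \<in> borel_measurable P" "\<beta> \<in> borel_measurable P"
    using measurable_compose[OF pair, of fst borel] measurable_compose[OF pair, of snd borel]
    by simp_all
  interpret N: prob_space N
    unfolding N_def by (rule P.prob_space_distr) simp
  interpret supercritical_affine N
  proof
    show "sets N = sets borel" by (simp add: N_def)
    have "AE \<omega> in P. \<alpha> \<omega> \<noteq> 0"
      using assms(3) by (subst (asm) P.prob_Collect_eq_1) auto
    then show "AE p in N. fst p \<noteq> 0"
      unfolding N_def by (subst AE_distr_iff) auto
    show "integrable N (\<lambda>p. ln \<bar>fst p\<bar>)" "integrable N (\<lambda>p. ln (max \<bar>snd p\<bar> 1))"
      unfolding N_def using assms(6,8) by (simp_all add: integrable_distr_eq)
    show "0 < N.expectation (\<lambda>p. ln \<bar>fst p\<bar>)"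
      unfolding N_def using assms(7) by (simp add: integral_distr)
    fix c
    have "\<not> (AE \<omega> in P. \<alpha> \<omega> * (c - \<beta> \<omega>) = c)"
      using assms(5) P.prob_Collect_eq_1[of "\<lambda>\<omega>. \<alpha> \<omega> * (c - \<beta> \<omega>) = c"] by (auto dest: spec[of _ c])
    then show "\<not> (AE p in N. fst p * (c - snd p) = c)"
      unfolding N_def by (subst AE_distr_iff) auto
  qed
  have meas[measurable]: "y \<in> borel_measurable borel"
    and "bounded (range y)" and y: "\<And>x. y x = P.expectation (\<lambda>\<omega>. y (\<alpha> \<omega> * (x - \<beta> \<omega>)))"
    using assms(9) unfolding bounded_solution_def by blast+
  obtain K where K: "\<And>x. \<bar>y x\<bar> \<le> K"
    using \<open>bounded (range y)\<close> by (auto simp: bounded_iff)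
  have yN: "y x = N.expectation (\<lambda>p. y (fst p * (x - snd p)))" for x
    by (subst y) (simp add: N_def integral_distr)
  \<comment> \<open>The equation is linear, so \<open>- y\<close> is a bounded solution too; its
    lower limits are the negated upper limits of \<open>y\<close>.\<close>
  have "min (Liminf at_top (\<lambda>t. ereal (- y t))) (Liminf at_bot (\<lambda>t. ereal (- y t))) \<le> ereal (- y x)"
    by (intro min_Liminf_le_solution[where K = K]) (simp_all add: K flip: yN)
  then have "ereal (y x) \<le> max (Limsup at_top (\<lambda>t. ereal (y t))) (Limsup at_bot (\<lambda>t. ereal (y t)))"
    by (simp add: ereal_Liminf_uminus[where f = "\<lambda>t. ereal (y t)", simplified] min_le_iff_disj
        le_max_iff_disj ereal_minus_le_minus[of _ "ereal (y x)", unfolded uminus_ereal.simps])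
  moreover have "min (Liminf at_top (\<lambda>t. ereal (y t))) (Liminf at_bot (\<lambda>t. ereal (y t))) \<le> ereal (y x)"
    using meas K yN by (rule min_Liminf_le_solution)
  ultimately show "min (Liminf at_top (\<lambda>t. ereal (y t))) (Liminf at_bot (\<lambda>t. ereal (y t))) \<le> ereal (y x) \<and>
      ereal (y x) \<le> max (Limsup at_top (\<lambda>t. ereal (y t))) (Limsup at_bot (\<lambda>t. ereal (y t)))"
    by blast
qed

end
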